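(* Let $c_1,\dots,c_9$ be complex numbers and let $\Psi:\mathbb{Z}^2\to\mathbb{C}$ be a given function. Consider the linear partial difference equation $$\begin{aligned}U_{i,j,k+1}={}&c_{1}U_{i-1,j-1,k}+c_{2}U_{i,j-1,k}+c_{3}U_{i+1,j-1,k}\\&+c_{4}U_{i-1,j,k}+c_{5}U_{i,j,k}+c_{6}U_{i+1,j,k}\\&+c_{7}U_{i-1,j+1,k}+c_{8}U_{i,j+1,k}+c_{9}U_{i+1,j+1,k}\end{aligned}\qquad (i,j\in\mathbb{Z},\ k\in\mathbb{N}\cup\{0\})$$ for an unknown function $U:\mathbb{Z}^2\times(\mathbb{N}\cup\{0\})\to\mathbb{C}$, $(i,j,k)\mapsto U_{i,j,k}$, with the initial condition $U_{i,j,0}=\Psi(i,j)$ for all $i,j\in\mathbb{Z}$. Then its solution is given, for all $i,j\in\mathbb{Z}$ and $k\in\mathbb{N}\cup\{0\}$, by $$U_{i,j,k}=\sum_{(s_1,\dots,s_9)\in I}\binom{k}{s_{1},s_{2},\dots,s_{9}}\,\Psi(i-a,j-b)\prod_{r=1}^{9}c_{r}^{s_r},$$ where $I$ is the set of all $9$-tuples of integers $(s_1,\dots,s_9)$ with $0\le s_r\le k$ for every $r$ and $\sum_{r=1}^{9}s_r=k$, and, for each such tuple, $a=s_{1}-s_{3}+s_{4}-s_{6}+s_{7}-s_{9}$ and $b=s_{1}+s_{2}+s_{3}-s_{7}-s_{8}-s_{9}$.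
   Context: $\mathbb{N}=\{1,2,\dots\}$. The symbol $\binom{k}{s_1,\dots,s_9}=\frac{k!}{s_1!\cdots s_9!}$ (for nonnegative integers with $s_1+\dots+s_9=k$) is the multinomial coefficient. The convention $0^0=1$ is used in powers of coefficients. *)

theory Defs
  imports Complex_Main "HOL-Library.FuncSet"
begin

(* Nine-tuples are functions on {1..9}; the extensional function space makes the
   correspondence with tuples one-to-one, so that each tuple is summed over exactly once. *)
definition tuples :: "nat \<Rightarrow> (nat \<Rightarrow> nat) set" where
  "tuples k = {s \<in> {1..9} \<rightarrow>\<^sub>E {0..k}. (\<Sum>r=1..9. s r) = k}"

definition multinomial :: "nat \<Rightarrow> (nat \<Rightarrow> nat) \<Rightarrow> complex" where
  "multinomial k s = fact k / (\<Prod>r=1..9. fact (s r))"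

definition shift_a :: "(nat \<Rightarrow> nat) \<Rightarrow> int" where
  "shift_a s = int (s 1) - int (s 3) + int (s 4) - int (s 6) + int (s 7) - int (s 9)"

definition shift_b :: "(nat \<Rightarrow> nat) \<Rightarrow> int" where
  "shift_b s = int (s 1) + int (s 2) + int (s 3) - int (s 7) - int (s 8) - int (s 9)"

end

theory Submission
  imports Defs
begin

text \<open>
  Both sides of the equivalence are determined by the initial values: a solution of the recurrence
  is computed level by level from level \<open>0\<close>. It therefore suffices that the closed formula
  itself has the right initial values and satisfies the recurrence; uniqueness then gives both
  directions.

  The recurrence for the formula rests on Pascal's rule for multinomial coefficients. A tuple \<open>s\<close>
  of total \<open>k\<close> records how often each of the nine stencil positions is used by a path of length
  \<open>k\<close>, the multinomial coefficient counts these paths, and \<open>(a, b)\<close> is their common displacement.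
  Splitting the paths of length \<open>k + 1\<close> by their last step \<open>r\<close> turns a sum over tuples of total
  \<open>k + 1\<close> into nine sums over tuples of total \<open>k\<close>, each evaluated at \<open>s\<close> with its \<open>r\<close>-th entry
  raised by one (lemma \<open>sum_tuples_Suc\<close>). Raising that entry multiplies the weight by \<open>c r\<close> and
  moves the argument of \<open>\<Psi>\<close> by the \<open>r\<close>-th stencil vector, which is the \<open>r\<close>-th term of the equation.
\<close>

lemma finite_tuples: "finite (tuples k)"
  unfolding tuples_def by (simp add: finite_PiE)

lemma tuples_0: "tuples 0 = {\<lambda>r\<in>{1..9}. 0}"
  unfolding tuples_def by (auto simp: PiE_def extensional_def restrict_def fun_eq_iff)

text \<open>
  The upper bound on the entries follows from their sum. In this form membership is easy to follow
  when a single entry is raised or lowered.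
\<close>

lemma mem_tuples_iff: "s \<in> tuples k \<longleftrightarrow> s \<in> extensional {1..9} \<and> (\<Sum>r=1..9. s r) = k"
proof -
  have "s r \<le> k" if "(\<Sum>r=1..9. s r) = k" "r \<in> {1..9}" for r
    using member_le_sum[of r "{1..9}" s] that by simp
  then show ?thesis
    unfolding tuples_def PiE_def Pi_def by auto
qed

lemma sum_raise:
  fixes t :: "nat \<Rightarrow> nat"
  assumes "finite A" "r \<in> A"
  shows "(\<Sum>q\<in>A. (t(r := Suc (t r))) q) = Suc (\<Sum>q\<in>A. t q)"
  using assms by (simp add: sum.remove)

lemma prod_raise:
  fixes f :: "nat \<Rightarrow> nat \<Rightarrow> 'a::comm_monoid_mult"
  assumes "finite A" "r \<in> A" "f r (Suc (t r)) = x * f r (t r)"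
  shows "(\<Prod>q\<in>A. f q ((t(r := Suc (t r))) q)) = x * (\<Prod>q\<in>A. f q (t q))"
  using assms by (simp add: prod.remove mult.assoc)

text \<open>
  This is the reindexing behind the removal of a last step \<open>r\<close>. Positivity of \<open>s r\<close> keeps the
  inverse, which lowers that entry, away from truncated subtraction.
\<close>

lemma bij_betw_raise:
  assumes "r \<in> {1..9}"
  shows "bij_betw (\<lambda>t. t(r := Suc (t r))) (tuples k) {s \<in> tuples (Suc k). s r > 0}"
proof (rule bij_betw_byWitness[where f' = "\<lambda>s. s(r := s r - 1)"])
  have up: "t(r := Suc (t r)) \<in> tuples (Suc k) \<longleftrightarrow> t \<in> tuples k" for t
    unfolding mem_tuples_iff sum_raise[OF finite_atLeastAtMost assms]
    using assms by (auto simp: extensional_def)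
  show "(\<lambda>t. t(r := Suc (t r))) ` tuples k \<subseteq> {s \<in> tuples (Suc k). s r > 0}"
    using up by auto
  show "(\<lambda>s. s(r := s r - 1)) ` {s \<in> tuples (Suc k). s r > 0} \<subseteq> tuples k"
  proof clarify
    fix s assume "s \<in> tuples (Suc k)" "s r > 0"
    then show "s(r := s r - 1) \<in> tuples k"
      using up[of "s(r := s r - 1)"] by simp
  qed
qed auto

text \<open>
  Among the paths described by the raised tuple, the fraction \<open>(t r + 1) / (k + 1)\<close> ends with
  position \<open>r\<close>; removing that last step leaves the paths described by \<open>t\<close>.
\<close>

lemma multinomial_raise:
  assumes "r \<in> {1..9}"
  shows "of_nat (Suc (t r)) * multinomial (Suc k) (t(r := Suc (t r)))
       = of_nat (Suc k) * multinomial k t"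
proof -
  have "(\<Prod>q=1..9. fact ((t(r := Suc (t r))) q)) = of_nat (Suc (t r)) * (\<Prod>q=1..9. fact (t q) :: complex)"
    by (rule prod_raise) (use assms in auto)
  then show ?thesis
    unfolding multinomial_def fact_Suc by (simp add: field_simps del: of_nat_Suc)
qed

text \<open>
  Pascal's rule in summed form. The factor \<open>k + 1\<close> equals the sum of the entries of \<open>s\<close>, so each
  tuple can be distributed over its positions in proportion to its entries; positions with entry
  \<open>0\<close> drop out, and the others are reindexed by lowering that entry.
\<close>

lemma sum_tuples_Suc:
  fixes F :: "(nat \<Rightarrow> nat) \<Rightarrow> complex"
  shows "(\<Sum>s\<in>tuples (Suc k). multinomial (Suc k) s * F s)
       = (\<Sum>r=1..9. \<Sum>t\<in>tuples k. multinomial k t * F (t(r := Suc (t r))))"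
proof -
  let ?G = "\<lambda>s. multinomial (Suc k) s * F s"
  have total: "of_nat (Suc k) * ?G s = (\<Sum>r=1..9. of_nat (s r) * ?G s)"
    if "s \<in> tuples (Suc k)" for s
  proof -
    have "(\<Sum>r=1..9. of_nat (s r)) = (of_nat (Suc k) :: complex)"
      using that by (simp add: mem_tuples_iff flip: of_nat_sum)
    then show ?thesis by (metis sum_distrib_right)
  qed
  have part: "(\<Sum>s\<in>tuples (Suc k). of_nat (s r) * ?G s)
      = of_nat (Suc k) * (\<Sum>t\<in>tuples k. multinomial k t * F (t(r := Suc (t r))))"
    if r: "r \<in> {1..9}" for r
  proof -
    have "(\<Sum>s\<in>tuples (Suc k). of_nat (s r) * ?G s)
        = (\<Sum>s\<in>{s \<in> tuples (Suc k). s r > 0}. of_nat (s r) * ?G s)"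
      by (rule sum.mono_neutral_right) (auto simp: finite_tuples)
    also have "\<dots> = (\<Sum>t\<in>tuples k. of_nat (Suc (t r)) * ?G (t(r := Suc (t r))))"
      by (subst sum.reindex_bij_betw[OF bij_betw_raise[OF r], symmetric]) simp
    also have "\<dots> = (\<Sum>t\<in>tuples k. of_nat (Suc k) * (multinomial k t * F (t(r := Suc (t r)))))"
      by (simp only: multinomial_raise[OF r] mult.assoc[symmetric])
    finally show ?thesis by (simp only: sum_distrib_left)
  qed
  have "of_nat (Suc k) * (\<Sum>s\<in>tuples (Suc k). ?G s)
      = (\<Sum>s\<in>tuples (Suc k). \<Sum>r=1..9. of_nat (s r) * ?G s)"
    unfolding sum_distrib_left by (rule sum.cong[OF refl total])
  also have "\<dots> = (\<Sum>r=1..9. \<Sum>s\<in>tuples (Suc k). of_nat (s r) * ?G s)"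
    by (rule sum.swap)
  also have "\<dots> = of_nat (Suc k) *
      (\<Sum>r=1..9. \<Sum>t\<in>tuples k. multinomial k t * F (t(r := Suc (t r))))"
    unfolding sum_distrib_left[of "of_nat (Suc k)" _ "{1..9}"] by (rule sum.cong[OF refl part])
  finally show ?thesis
    by (simp del: of_nat_Suc)
qed

definition path_sum ::
    "(nat \<Rightarrow> complex) \<Rightarrow> (int \<Rightarrow> int \<Rightarrow> complex) \<Rightarrow> int \<Rightarrow> int \<Rightarrow> nat \<Rightarrow> complex" where
  "path_sum c \<Psi> i j k =
     (\<Sum>s\<in>tuples k. multinomial k s * \<Psi> (i - shift_a s) (j - shift_b s) * (\<Prod>r=1..9. c r ^ s r))"

lemma path_sum_0: "path_sum c \<Psi> i j 0 = \<Psi> i j"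
  by (simp add: path_sum_def tuples_0 multinomial_def shift_a_def shift_b_def)

abbreviation unit_tuple :: "nat \<Rightarrow> nat \<Rightarrow> nat" where
  "unit_tuple r \<equiv> (\<lambda>_. 0)(r := 1)"

text \<open>
  The displacement is additive in the tuple, so the displacement of the unit tuple at \<open>r\<close> is the
  stencil vector belonging to \<open>c r\<close>.
\<close>

lemma shift_raise:
  "shift_a (t(r := Suc (t r))) = shift_a (unit_tuple r) + shift_a t"
  "shift_b (t(r := Suc (t r))) = shift_b (unit_tuple r) + shift_b t"
  unfolding shift_a_def shift_b_def by auto

lemma path_sum_Suc:
  "path_sum c \<Psi> i j (Suc k) =
     (\<Sum>r=1..9. c r * path_sum c \<Psi> (i - shift_a (unit_tuple r)) (j - shift_b (unit_tuple r)) k)"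
proof -
  let ?F = "\<lambda>s. \<Psi> (i - shift_a s) (j - shift_b s) * (\<Prod>q=1..9. c q ^ s q)"
  have "path_sum c \<Psi> i j (Suc k)
      = (\<Sum>r=1..9. \<Sum>t\<in>tuples k. multinomial k t * ?F (t(r := Suc (t r))))"
    unfolding path_sum_def mult.assoc by (rule sum_tuples_Suc)
  also have "\<dots> = (\<Sum>r=1..9. c r *
      path_sum c \<Psi> (i - shift_a (unit_tuple r)) (j - shift_b (unit_tuple r)) k)"
  proof (rule sum.cong[OF refl])
    fix r :: nat assume r: "r \<in> {1..9}"
    have "(\<Prod>q=1..9. c q ^ (t(r := Suc (t r))) q) = c r * (\<Prod>q=1..9. c q ^ t q)" for t
      by (rule prod_raise) (use r in auto)
    then show "(\<Sum>t\<in>tuples k. multinomial k t * ?F (t(r := Suc (t r))))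
        = c r * path_sum c \<Psi> (i - shift_a (unit_tuple r)) (j - shift_b (unit_tuple r)) k"
      unfolding path_sum_def sum_distrib_left shift_raise diff_diff_eq
      by (simp only: mult_ac)
  qed
  finally show ?thesis .
qed

lemma path_sum_recurrence:
  "path_sum c \<Psi> i j (k + 1) =
     c 1 * path_sum c \<Psi> (i - 1) (j - 1) k + c 2 * path_sum c \<Psi> i (j - 1) k
   + c 3 * path_sum c \<Psi> (i + 1) (j - 1) k
   + c 4 * path_sum c \<Psi> (i - 1) j k + c 5 * path_sum c \<Psi> i j k + c 6 * path_sum c \<Psi> (i + 1) j k
   + c 7 * path_sum c \<Psi> (i - 1) (j + 1) k + c 8 * path_sum c \<Psi> i (j + 1) k
   + c 9 * path_sum c \<Psi> (i + 1) (j + 1) k"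
proof -
  have nine: "{1..9::nat} = {1, 2, 3, 4, 5, 6, 7, 8, 9}"
    by auto
  show ?thesis
    unfolding Suc_eq_plus1[symmetric] path_sum_Suc nine
    by (simp add: shift_a_def shift_b_def)
qed

theorem theorem4p1:
  fixes c :: "nat \<Rightarrow> complex"
    and \<Psi> :: "int \<Rightarrow> int \<Rightarrow> complex"
    and U :: "int \<Rightarrow> int \<Rightarrow> nat \<Rightarrow> complex"
  shows "((\<forall>i j k. U i j (k + 1) =
              c 1 * U (i - 1) (j - 1) k + c 2 * U i (j - 1) k + c 3 * U (i + 1) (j - 1) k
            + c 4 * U (i - 1) j k       + c 5 * U i j k       + c 6 * U (i + 1) j k
            + c 7 * U (i - 1) (j + 1) k + c 8 * U i (j + 1) k + c 9 * U (i + 1) (j + 1) k)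
          \<and> (\<forall>i j. U i j 0 = \<Psi> i j))
     \<longleftrightarrow> (\<forall>i j k. U i j k =
            (\<Sum>s\<in>tuples k. multinomial k s * \<Psi> (i - shift_a s) (j - shift_b s)
                            * (\<Prod>r=1..9. c r ^ s r)))"
  (is "?rec \<and> ?init \<longleftrightarrow> ?formula")
proof -
  have formula: "?formula \<longleftrightarrow> (\<forall>i j k. U i j k = path_sum c \<Psi> i j k)"
    by (simp only: path_sum_def)
  show ?thesis
  proof
    assume sol: "?rec \<and> ?init"
    have "\<forall>i j. U i j k = path_sum c \<Psi> i j k" for k
    proof (induction k)
      case 0
      show ?case using sol by (simp add: path_sum_0)
    next
      case (Suc k)
      show ?case
        unfolding Suc_eq_plus1 path_sum_recurrence using sol Suc.IH by simp
    qed
    then show ?formula unfolding formula by blast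
  next
    assume ?formula
    then have "U = path_sum c \<Psi>"
      unfolding formula by (simp add: fun_eq_iff)
    then show "?rec \<and> ?init"
      by (simp only: path_sum_recurrence path_sum_0) simp
  qed
qed

end
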